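(* For every integer $n \geq 3$, the $3$-token graph of the path $P_n$ is isomorphic to the cubical staircase graph: $\Gamma_3(P_n) \cong CS_n$.
   Context: All graphs are finite, simple and undirected. $P_n$ is the path with vertices $x_1,\dots,x_n$ and edges $x_ix_{i+1}$ ($1\le i\le n-1$). The $3$-token graph $\Gamma_3(G)$ has as vertices the $3$-element subsets of $V(G)$, two distinct subsets $A,B$ being adjacent iff $A\triangle B=\{x,y\}$ with $xy\in E(G)$. For $n \geq 3$, the cubical staircase graph $CS_n$ is the graph with vertex set $\{(i,j,k) : 1 \leq i \leq n-2,\ 1 \leq j \leq i,\ 1 \leq k \leq n-1-i\}$ and edge set consisting of the pairs $(i,j,k)(i,j,k+1)$ for $1\le i\le n-2$, $1\le j\le i$, $1\le k\le n-2-i$; the pairs $(i,j,k)(i+1,j,k)$ for $1\le i\le n-3$, $1\le j\le i$, $1\le k\le n-1-i$; and the pairs $(i,j,k)(i,j+1,k)$ for $1\le i\le n-2$, $1\le j\le i-1$, $1\le k\le n-1-i$ (only pairs of vertices of $CS_n$ are included). *)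

theory Defs
  imports "Graph_Theory.Graph_Theory"
begin

text \<open>
  Simple undirected graphs are represented, as usual in this library, by finite loop-free
  symmetric digraphs without parallel arcs (\<^locale>\<open>pair_graph\<close>): an edge \<open>xy\<close> is the pair of
  arcs \<open>(x, y)\<close> and \<open>(y, x)\<close>. For such digraphs \<^const>\<open>digraph_iso\<close> is isomorphism of
  graphs. Where edges are listed in one direction only, \<^const>\<open>mk_symmetric\<close> adds the reverse arcs.
\<close>

text \<open>The vertex \<open>x\<^sub>i\<close> of the path is represented by its index \<open>i\<close>.\<close>

definition path_graph :: "nat \<Rightarrow> nat pair_pre_digraph" where
  "path_graph n = mk_symmetric (with_proj
     \<lparr> pverts = {1..n},
       parcs = {(i, i + 1) | i. 1 \<le> i \<and> i \<le> n - 1} \<rparr>)"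

definition token_graph :: "nat \<Rightarrow> 'a pair_pre_digraph \<Rightarrow> 'a set pair_pre_digraph" where
  "token_graph k G =
     \<lparr> pverts = {A. A \<subseteq> pverts G \<and> card A = k},
       parcs = {(A, B). A \<subseteq> pverts G \<and> card A = k \<and> B \<subseteq> pverts G \<and> card B = k \<and> A \<noteq> B \<and>
                  (\<exists>x y. sym_diff A B = {x, y} \<and> (x, y) \<in> parcs G)} \<rparr>"

text \<open>
  The index ranges of the second family of pairs do not by themselves force the second vertex to
  lie in the graph (take \<open>k = n - 1 - i\<close>), hence the intersection with \<open>V \<times> V\<close>. For \<open>n \<ge> 3\<close>
  no relevant subtraction on \<^typ>\<open>nat\<close> is truncated.
\<close>

definition cs_verts :: "nat \<Rightarrow> (nat \<times> nat \<times> nat) set" where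
  "cs_verts n = {(i, j, k). 1 \<le> i \<and> i \<le> n - 2 \<and> 1 \<le> j \<and> j \<le> i \<and> 1 \<le> k \<and> k \<le> n - 1 - i}"

definition cubical_staircase :: "nat \<Rightarrow> (nat \<times> nat \<times> nat) pair_pre_digraph" where
  "cubical_staircase n = mk_symmetric (with_proj
     \<lparr> pverts = cs_verts n,
       parcs =
         ({((i, j, k), (i, j, k + 1)) | i j k.
             1 \<le> i \<and> i \<le> n - 2 \<and> 1 \<le> j \<and> j \<le> i \<and> 1 \<le> k \<and> k \<le> n - 2 - i} \<union>
          {((i, j, k), (i + 1, j, k)) | i j k.
             1 \<le> i \<and> i \<le> n - 3 \<and> 1 \<le> j \<and> j \<le> i \<and> 1 \<le> k \<and> k \<le> n - 1 - i} \<union>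
          {((i, j, k), (i, j + 1, k)) | i j k.
             1 \<le> i \<and> i \<le> n - 2 \<and> 1 \<le> j \<and> j \<le> i - 1 \<and> 1 \<le> k \<and> k \<le> n - 1 - i})
         \<inter> (cs_verts n \<times> cs_verts n) \<rparr>)"

lemma pair_graph_mk_symmetricI:
  assumes "finite V" "E \<subseteq> V \<times> V" "irrefl E"
  shows "pair_graph (mk_symmetric (with_proj \<lparr> pverts = V, parcs = E \<rparr>))"
proof -
  have *: "a \<in> V" "b \<in> V" "a \<noteq> b" if "(a, b) \<in> E" for a b
    using that assms by (auto simp: irrefl_def)
  have fin: "finite E"
    using assms by (meson finite_SigmaI finite_subset)
  have "pair_digraph \<lparr> pverts = V, parcs = E \<rparr>"
  proof
    fix e assume "e \<in> parcs \<lparr> pverts = V, parcs = E \<rparr>"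
    then show "fst e \<in> pverts \<lparr> pverts = V, parcs = E \<rparr>"
      and "snd e \<in> pverts \<lparr> pverts = V, parcs = E \<rparr>"
      and "fst e \<noteq> snd e"
      using *[of "fst e" "snd e"] by simp_all
  qed (simp_all add: fin assms(1))
  then interpret D: pair_digraph "\<lparr> pverts = V, parcs = E \<rparr>" .
  interpret S: pair_digraph "mk_symmetric (with_proj \<lparr> pverts = V, parcs = E \<rparr>)"
    by (rule D.digraph_mk_symmetric)
  show ?thesis
    by unfold_locales (rule symmetric_mk_symmetric)
qed

lemma pair_graph_path_graph: "pair_graph (path_graph n)"
  unfolding path_graph_def by (rule pair_graph_mk_symmetricI) (auto simp: irrefl_def)

lemma finite_cs_verts: "finite (cs_verts n)"
  by (rule finite_subset[of _ "{..n} \<times> {..n} \<times> {..n}"]) (auto simp: cs_verts_def)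

lemma pair_graph_cubical_staircase: "pair_graph (cubical_staircase n)"
  unfolding cubical_staircase_def
  by (rule pair_graph_mk_symmetricI[OF finite_cs_verts Int_lower2]) (auto simp: irrefl_def)

lemma pair_graph_token_graph:
  assumes "pair_graph G"
  shows "pair_graph (token_graph k G)"
proof -
  interpret pair_graph G by fact
  let ?T = "token_graph k G"
  have fin: "finite (pverts ?T)"
    by (rule finite_subset[of _ "Pow (pverts G)"]) (auto simp: token_graph_def)
  have sub: "parcs ?T \<subseteq> pverts ?T \<times> pverts ?T" and irr: "irrefl (parcs ?T)"
    by (auto simp: token_graph_def irrefl_def)
  have sym: "sym (parcs ?T)"
    unfolding token_graph_def by (rule symI) (auto simp: Un_commute)
  have fin': "finite (parcs ?T)"
    using finite_subset[OF sub finite_cartesian_product[OF fin fin]] .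
  show ?thesis
  proof
    fix e assume e: "e \<in> parcs ?T"
    then show "fst e \<in> pverts ?T" "snd e \<in> pverts ?T"
      using sub by (metis mem_Times_iff subsetD)+
    show "fst e \<noteq> snd e"
      using e irr by (metis irreflD prod.collapse)
  next
    show "symmetric (with_proj ?T)"
      using sym by (simp add: symmetric_def)
  qed (fact fin fin')+
qed

end

theory Submission
  imports Defs
begin

text \<open>
  A token configuration \<open>{a < b < c}\<close> of the path corresponds to the vertex
  \<open>(i, j, k) = (b - 1, a, n + 1 - c)\<close> of the staircase. Tokens on a path never overtake each other,
  so an edge of the token graph changes exactly one of \<open>a\<close>, \<open>b\<close>, \<open>c\<close> by one, and the
  constraints \<open>1 \<le> a < b < c \<le> n\<close> are exactly the index ranges of the staircase.
\<close>

section \<open>Isomorphisms from vertex bijections\<close>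

text \<open>Arcs here are pairs, so the arc map is forced to be \<open>map_prod f f\<close>. The
  last assumption puts both ends of every arc of \<open>H\<close> in the image of \<open>f\<close>,
  which makes the arc map surjective.\<close>

lemma digraph_iso_with_projI:
  assumes "pair_wf_digraph G"
    and bij: "bij_betw f (pverts G) (pverts H)"
    and arcs: "\<And>u v. u \<in> pverts G \<Longrightarrow> v \<in> pverts G \<Longrightarrow> (f u, f v) \<in> parcs H \<longleftrightarrow> (u, v) \<in> parcs G"
    and sub: "parcs H \<subseteq> pverts H \<times> pverts H"
  shows "digraph_iso (with_proj G) (with_proj H)"
proof -
  interpret pair_wf_digraph G by fact
  define h where "h = \<lparr> iso_verts = f, iso_arcs = map_prod f f, iso_head = snd, iso_tail = fst \<rparr>"
  have inj: "inj_on f (pverts G)" and img: "f ` pverts G = pverts H"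
    using bij by (auto simp: bij_betw_def)
  have subG: "parcs G \<subseteq> pverts G \<times> pverts G"
    by (auto dest: in_arcsD1 in_arcsD2)
  have "inj_on (map_prod f f) (parcs G)"
    using map_prod_inj_on[OF inj inj] subG by (rule inj_on_subset)
  then have "digraph_isomorphism h"
    using inj wf_digraph_axioms unfolding digraph_isomorphism_def by (simp add: h_def)
  moreover have "map_prod f f ` parcs G = parcs H"
  proof
    show "map_prod f f ` parcs G \<subseteq> parcs H"
    proof (rule image_subsetI)
      fix e assume "e \<in> parcs G"
      then show "map_prod f f e \<in> parcs H"
        using arcs[of "fst e" "snd e"] by (cases e) (simp add: wellformed')
    qed
    show "parcs H \<subseteq> map_prod f f ` parcs G"
    proof
      fix e assume e: "e \<in> parcs H"
      then have "e \<in> (f ` pverts G) \<times> (f ` pverts G)"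
        using sub img by blast
      then obtain u v where uv: "u \<in> pverts G" "v \<in> pverts G" "e = (f u, f v)"
        by blast
      then have "(u, v) \<in> parcs G"
        using e arcs by simp
      then show "e \<in> map_prod f f ` parcs G"
        using uv(3) by (metis image_eqI map_prod_simp)
    qed
  qed
  \<comment> \<open>\<open>H\<close> is literally the image of \<open>G\<close> under
    \<open>h\<close>, as \<open>digraph_iso\<close> asks.\<close>
  then have "with_proj H = app_iso h (with_proj G)"
    using img by (simp add: app_iso_def with_proj_def h_def)
  ultimately show ?thesis
    unfolding digraph_iso_def by blast
qed

section \<open>Edges of token graphs and paths\<close>

text \<open>Equal cardinality makes \<open>A - B\<close> and \<open>B - A\<close> equally large, so
  a two-element symmetric difference consists of one element that leaves and one that enters. The
  disjunction is over which of the two leaves.\<close>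

lemma sym_diff_eq_doubleton:
  assumes "finite A" "finite B" "card A = card B" "x \<noteq> y" "sym_diff A B = {x, y}"
  shows "x \<in> A \<and> y \<notin> A \<and> B = insert y (A - {x}) \<or> y \<in> A \<and> x \<notin> A \<and> B = insert x (A - {y})"
proof -
  have "card (A - B) = card (B - A)"
    using assms(1-3) by (metis Int_commute card_Diff_subset_Int finite_Int)
  moreover have "card (A - B) + card (B - A) = card (sym_diff A B)"
    using assms(1,2) by (subst card_Un_disjoint) auto
  ultimately have "card (A - B) = 1" "card (B - A) = 1"
    using assms(4,5) by simp_all
  then obtain p q where pq: "A - B = {p}" "B - A = {q}"
    by (auto simp: card_1_singleton_iff)
  then have "{p, q} = {x, y}"
    using assms(5) by auto
  then have "p = x \<and> q = y \<or> p = y \<and> q = x"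
    by (auto simp: doubleton_eq_iff)
  moreover have "p \<in> A" "q \<notin> A" "B = insert q (A - {p})"
    using pq by auto
  ultimately show ?thesis
    by auto
qed

text \<open>Replaces the unordered symmetric difference by a directed move: one token slides along
  an arc to an unoccupied vertex.\<close>

lemma parcs_token_graph_iff:
  assumes "pair_graph G"
    and A: "A \<in> pverts (token_graph k G)" and B: "B \<in> pverts (token_graph k G)"
  shows "(A, B) \<in> parcs (token_graph k G) \<longleftrightarrow>
    (\<exists>x y. (x, y) \<in> parcs G \<and> x \<in> A \<and> y \<notin> A \<and> B = insert y (A - {x}))"
    (is "?L \<longleftrightarrow> ?R")
proof -
  interpret pair_graph G by fact
  have AB: "A \<subseteq> pverts G" "card A = k" "B \<subseteq> pverts G" "card B = k"
    using A B by (auto simp: token_graph_def)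
  then have fin: "finite A" "finite B"
    using finite_subset[OF _ finite_verts] by auto
  show ?thesis
  proof
    assume ?L
    then obtain x y where xy: "sym_diff A B = {x, y}" "(x, y) \<in> parcs G"
      by (auto simp: token_graph_def)
    moreover from xy(2) have "x \<noteq> y"
      using no_loops' by blast
    \<comment> \<open>The reversed arc serves the case in which the token leaves \<open>y\<close>
      and enters \<open>x\<close>.\<close>
    moreover from xy(2) have "(y, x) \<in> parcs G"
      by (rule arcs_symmetric)
    ultimately show ?R
      using sym_diff_eq_doubleton[OF fin] AB by metis
  next
    assume ?R
    then obtain x y where "(x, y) \<in> parcs G" "x \<in> A" "y \<notin> A" "B = insert y (A - {x})"
      by blast
    moreover from this have "sym_diff A B = {x, y}"
      by auto
    ultimately show ?L
      using AB by (auto simp: token_graph_def)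
  qed
qed

lemma parcs_mk_symmetric_with_proj_iff:
  "(u, v) \<in> parcs (mk_symmetric (with_proj G)) \<longleftrightarrow> (u, v) \<in> parcs G \<or> (v, u) \<in> parcs G"
  by (auto simp: parcs_mk_symmetric intro: bexI[of _ "(u, v)"] bexI[of _ "(v, u)"])

lemma parcs_path_graph_iff:
  "(x, y) \<in> parcs (path_graph n) \<longleftrightarrow>
    x \<in> {1..n} \<and> y \<in> {1..n} \<and> (y = x + 1 \<or> x = y + 1)"
  by (auto simp: path_graph_def parcs_mk_symmetric_with_proj_iff)

section \<open>Sorted triples and unit moves\<close>

text \<open>The set determines its minimum and maximum, and the middle entry is what
  remains.\<close>

lemma sorted_triple_eq_iff:
  fixes a b c :: "'a :: linorder"
  assumes "a < b" "b < c" "a' < b'" "b' < c'"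
  shows "{a, b, c} = {a', b', c'} \<longleftrightarrow> a = a' \<and> b = b' \<and> c = c'"
proof
  assume eq: "{a, b, c} = {a', b', c'}"
  have "a = Min {a, b, c}" "a' = Min {a', b', c'}" "c = Max {a, b, c}" "c' = Max {a', b', c'}"
    using assms by (auto simp: min_def max_def)
  then have "a = a'" "c = c'"
    using eq by metis+
  moreover from this have "b = b'"
    using eq assms by auto
  ultimately show "a = a' \<and> b = b' \<and> c = c'"
    by simp
qed simp

text \<open>A unit step onto an unoccupied number cannot pass a neighbouring entry. Replacing
  \<open>x\<close> by \<open>y\<close> in place thus keeps the triple sorted, and sorted triples can
  be compared entry by entry.\<close>

lemma sorted_triple_move_iff:
  fixes a b c :: nat
  assumes abc: "a < b" "b < c" and abc': "a' < b'" "b' < c'"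
  shows "(\<exists>x y. (y = x + 1 \<or> x = y + 1) \<and> x \<in> {a, b, c} \<and> y \<notin> {a, b, c} \<and>
      {a', b', c'} = insert y ({a, b, c} - {x})) \<longleftrightarrow>
    b' = b \<and> c' = c \<and> (a' = a + 1 \<or> a = a' + 1) \<or>
    a' = a \<and> c' = c \<and> (b' = b + 1 \<or> b = b' + 1) \<or>
    a' = a \<and> b' = b \<and> (c' = c + 1 \<or> c = c' + 1)"
    (is "?L \<longleftrightarrow> ?R")
proof
  assume ?L
  then obtain x y where xy: "y = x + 1 \<or> x = y + 1" "x \<in> {a, b, c}" "y \<notin> {a, b, c}"
    and eq: "{a', b', c'} = insert y ({a, b, c} - {x})"
    by blast
  from xy(2) consider "x = a" | "x = b" | "x = c"
    by auto
  then show ?R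
  proof cases
    case 1
    \<comment> \<open>\<open>y\<close> is at most \<open>a + 1\<close>, hence at most
      \<open>b\<close>, and it differs from \<open>b\<close>.\<close>
    then have bounds: "y < b"
      using xy(1,3) abc by auto
    have "{a, b, c} - {x} = {b, c}"
      using 1 abc by auto
    then have "{a', b', c'} = {y, b, c}"
      using eq by (simp add: insert_commute)
    then have "a' = y \<and> b' = b \<and> c' = c"
      using sorted_triple_eq_iff[OF abc', of y b c] bounds abc by simp
    then show ?thesis
      using 1 xy(1) by auto
  next
    case 2
    then have bounds: "a < y" "y < c"
      using xy(1,3) abc by auto
    have "{a, b, c} - {x} = {a, c}"
      using 2 abc by auto
    then have "{a', b', c'} = {a, y, c}"
      using eq by (simp add: insert_commute)
    then have "a' = a \<and> b' = y \<and> c' = c"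
      using sorted_triple_eq_iff[OF abc', of a y c] bounds abc by simp
    then show ?thesis
      using 2 xy(1) by auto
  next
    case 3
    then have bounds: "b < y"
      using xy(1,3) abc by auto
    have "{a, b, c} - {x} = {a, b}"
      using 3 abc by auto
    then have "{a', b', c'} = {a, b, y}"
      using eq by (simp add: insert_commute)
    then have "a' = a \<and> b' = b \<and> c' = y"
      using sorted_triple_eq_iff[OF abc', of a b y] bounds abc by simp
    then show ?thesis
      using 3 xy(1) by auto
  qed
next
  assume ?R
  then consider "b' = b" "c' = c" "a' = a + 1 \<or> a = a' + 1"
    | "a' = a" "c' = c" "b' = b + 1 \<or> b = b' + 1"
    | "a' = a" "b' = b" "c' = c + 1 \<or> c = c' + 1"
    by blast
  then show ?L
  proof cases
    \<comment> \<open>The witnesses are the old and new values of the changed entry; strict order of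
      the new triple shows that the new value was unoccupied.\<close>
    case 1
    then show ?thesis using abc abc' by (intro exI[of _ a] exI[of _ a']) auto
  next
    case 2
    then show ?thesis using abc abc' by (intro exI[of _ b] exI[of _ b']) auto
  next
    case 3
    then show ?thesis using abc abc' by (intro exI[of _ c] exI[of _ c']) auto
  qed
qed

section \<open>Edges of the staircase\<close>

text \<open>The staircase is the subgraph of the cubic lattice induced on \<open>cs_verts n\<close>:
  between two vertices, the index bounds of each family follow from membership of the
  endpoints.\<close>

lemma parcs_cubical_staircase_iff:
  "((i, j, k), (i', j', k')) \<in> parcs (cubical_staircase n) \<longleftrightarrow>
    (i, j, k) \<in> cs_verts n \<and> (i', j', k') \<in> cs_verts n \<and>
    (i' = i \<and> j' = j \<and> (k' = k + 1 \<or> k = k' + 1) \<or>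
     j' = j \<and> k' = k \<and> (i' = i + 1 \<or> i = i' + 1) \<or>
     i' = i \<and> k' = k \<and> (j' = j + 1 \<or> j = j' + 1))"
proof -
  define E where "E =
    {((i, j, k), (i, j, k + 1)) | i j k.
       1 \<le> i \<and> i \<le> n - 2 \<and> 1 \<le> j \<and> j \<le> i \<and> 1 \<le> k \<and> k \<le> n - 2 - i} \<union>
    {((i, j, k), (i + 1, j, k)) | i j k.
       1 \<le> i \<and> i \<le> n - 3 \<and> 1 \<le> j \<and> j \<le> i \<and> 1 \<le> k \<and> k \<le> n - 1 - i} \<union>
    {((i, j, k), (i, j + 1, k)) | i j k.
       1 \<le> i \<and> i \<le> n - 2 \<and> 1 \<le> j \<and> j \<le> i - 1 \<and> 1 \<le> k \<and> k \<le> n - 1 - i}"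
  \<comment> \<open>The coordinates are generalized because both orientations of a pair are needed
    below.\<close>
  have E_iff: "((i, j, k), (i', j', k')) \<in> E \<longleftrightarrow>
      i' = i \<and> j' = j \<and> k' = k + 1 \<or>
      j' = j \<and> k' = k \<and> i' = i + 1 \<or>
      i' = i \<and> k' = k \<and> j' = j + 1"
    if "(i, j, k) \<in> cs_verts n" "(i', j', k') \<in> cs_verts n" for i j k i' j' k'
  proof -
    \<comment> \<open>The first endpoint supplies all bounds but one per family, the one on the
      increasing coordinate; the second endpoint then supplies that one.\<close>
    have "((i, j, k), (i', j', k')) \<in> E \<longleftrightarrow>
        i' = i \<and> j' = j \<and> k' = k + 1 \<and> k \<le> n - 2 - i \<or>
        j' = j \<and> k' = k \<and> i' = i + 1 \<and> i \<le> n - 3 \<or>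
        i' = i \<and> k' = k \<and> j' = j + 1 \<and> j \<le> i - 1"
      using that(1) by (simp add: E_def cs_verts_def) blast
    moreover have "k \<le> n - 2 - i" if "i' = i" "k' = k + 1"
      using that \<open>(i', j', k') \<in> cs_verts n\<close> by (auto simp: cs_verts_def)
    moreover have "i \<le> n - 3" if "i' = i + 1"
      using that \<open>(i', j', k') \<in> cs_verts n\<close> by (auto simp: cs_verts_def)
    moreover have "j \<le> i - 1" if "i' = i" "j' = j + 1"
      using that \<open>(i', j', k') \<in> cs_verts n\<close> by (auto simp: cs_verts_def)
    ultimately show ?thesis
      by blast
  qed
  have "cubical_staircase n = mk_symmetric (with_proj
      \<lparr> pverts = cs_verts n, parcs = E \<inter> (cs_verts n \<times> cs_verts n) \<rparr>)"
    by (simp only: cubical_staircase_def E_def)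
  then have "((i, j, k), (i', j', k')) \<in> parcs (cubical_staircase n) \<longleftrightarrow>
      (i, j, k) \<in> cs_verts n \<and> (i', j', k') \<in> cs_verts n \<and>
      (((i, j, k), (i', j', k')) \<in> E \<or> ((i', j', k'), (i, j, k)) \<in> E)"
    by (simp add: parcs_mk_symmetric_with_proj_iff) blast
  then show ?thesis
    using E_iff by blast
qed

section \<open>The correspondence\<close>

text \<open>The map starts from the staircase, since forming a set from a triple needs no sorting.
  The last token is counted from the far end of the path.\<close>

definition tokens :: "nat \<Rightarrow> nat \<times> nat \<times> nat \<Rightarrow> nat set" where
  "tokens n = (\<lambda>(i, j, k). {j, i + 1, n + 1 - k})"

text \<open>The staircase bounds become the strict order of the tokens within the path. The last
  fact keeps \<open>n + 1 - k\<close> from truncating, so that \<open>k\<close> can be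
  recovered.\<close>

lemma cs_vertsD:
  assumes "(i, j, k) \<in> cs_verts n"
  shows "1 \<le> j" "j < i + 1" "i + 1 < n + 1 - k" "n + 1 - k \<le> n" "k \<le> n"
  using assms by (auto simp: cs_verts_def)

lemma bij_betw_tokens:
  "bij_betw (tokens n) (cs_verts n) (pverts (token_graph 3 (path_graph n)))"
proof (rule bij_betw_imageI)
  show "inj_on (tokens n) (cs_verts n)"
  proof (rule inj_onI)
    fix u v
    assume "u \<in> cs_verts n" "v \<in> cs_verts n" and eq: "tokens n u = tokens n v"
    moreover obtain i j k i' j' k' where uv: "u = (i, j, k)" "v = (i', j', k')"
      by (metis prod_cases3)
    ultimately have u: "(i, j, k) \<in> cs_verts n" and v: "(i', j', k') \<in> cs_verts n"
      by simp_all
    have "{j, i + 1, n + 1 - k} = {j', i' + 1, n + 1 - k'}"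
      using eq by (simp add: tokens_def uv)
    then have "j = j' \<and> i + 1 = i' + 1 \<and> n + 1 - k = n + 1 - k'"
      by (simp only: sorted_triple_eq_iff[OF cs_vertsD(2,3)[OF u] cs_vertsD(2,3)[OF v]])
    then show "u = v"
      using cs_vertsD(5)[OF u] cs_vertsD(5)[OF v] by (auto simp: uv)
  qed
  show "tokens n ` cs_verts n = pverts (token_graph 3 (path_graph n))"
  proof
    show "tokens n ` cs_verts n \<subseteq> pverts (token_graph 3 (path_graph n))"
    proof clarify
      fix i j k assume v: "(i, j, k) \<in> cs_verts n"
      show "tokens n (i, j, k) \<in> pverts (token_graph 3 (path_graph n))"
        using cs_vertsD[OF v] by (auto simp: tokens_def token_graph_def path_graph_def)
    qed
    show "pverts (token_graph 3 (path_graph n)) \<subseteq> tokens n ` cs_verts n"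
    proof
      fix A assume "A \<in> pverts (token_graph 3 (path_graph n))"
      then have A: "A \<subseteq> {1..n}" "card A = 3"
        by (auto simp: token_graph_def path_graph_def)
      \<comment> \<open>Sorting names the three tokens in increasing order.\<close>
      define xs where "xs = sorted_list_of_set A"
      have fin: "finite A"
        using A(1) finite_subset by blast
      have "length xs = 3"
        using A(2) by (simp add: xs_def)
      then obtain a b c where xs: "xs = [a, b, c]"
        by (auto simp: numeral_3_eq_3 length_Suc_conv)
      moreover have "sorted_wrt (<) xs" "set xs = A"
        using fin by (simp_all add: xs_def)
      ultimately have abc: "a < b" "b < c" "A = {a, b, c}"
        by auto
      \<comment> \<open>No subtraction truncates, because \<open>a < b\<close> and
        \<open>c \<le> n\<close>.\<close>
      then have "A = tokens n (b - 1, a, n + 1 - c)" "(b - 1, a, n + 1 - c) \<in> cs_verts n"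
        using A(1) by (auto simp: tokens_def cs_verts_def)
      then show "A \<in> tokens n ` cs_verts n"
        by blast
    qed
  qed
qed

text \<open>Both adjacencies are reduced to a unit change in exactly one coordinate, and these
  changes are matched.\<close>

lemma parcs_tokens_iff:
  assumes v: "v \<in> cs_verts n" and w: "w \<in> cs_verts n"
  shows "(tokens n v, tokens n w) \<in> parcs (token_graph 3 (path_graph n)) \<longleftrightarrow>
    (v, w) \<in> parcs (cubical_staircase n)"
proof -
  obtain i j k i' j' k' where vw: "v = (i, j, k)" "w = (i', j', k')"
    by (metis prod_cases3)
  note d = cs_vertsD[OF v[unfolded vw]] and d' = cs_vertsD[OF w[unfolded vw]]
  have verts: "tokens n v \<in> pverts (token_graph 3 (path_graph n))"
    "tokens n w \<in> pverts (token_graph 3 (path_graph n))"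
    using bij_betw_apply[OF bij_betw_tokens] v w by auto
  then have sub: "tokens n v \<subseteq> {1..n}" "tokens n w \<subseteq> {1..n}"
    by (auto simp: token_graph_def path_graph_def)
  have "(tokens n v, tokens n w) \<in> parcs (token_graph 3 (path_graph n)) \<longleftrightarrow>
    (\<exists>x y. (x, y) \<in> parcs (path_graph n) \<and> x \<in> tokens n v \<and> y \<notin> tokens n v \<and>
      tokens n w = insert y (tokens n v - {x}))"
    by (rule parcs_token_graph_iff[OF pair_graph_path_graph verts])
  \<comment> \<open>Since \<open>x\<close> lies in the old configuration and \<open>y\<close> in the
    new one, both are in \<open>{1..n}\<close> already.\<close>
  also have "\<dots> \<longleftrightarrow> (\<exists>x y. (y = x + 1 \<or> x = y + 1) \<and> x \<in> tokens n v \<and> y \<notin> tokens n v \<and>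
      tokens n w = insert y (tokens n v - {x}))"
    unfolding parcs_path_graph_iff using sub by blast
  also have "\<dots> \<longleftrightarrow> (v, w) \<in> parcs (cubical_staircase n)"
  proof -
    \<comment> \<open>Reflecting \<open>k\<close> exchanges raising and lowering, while
      \<open>i\<close> is only shifted.\<close>
    have "n + 1 - k' = n + 1 - k \<longleftrightarrow> k' = k"
      "n + 1 - k' = n + 1 - k + 1 \<longleftrightarrow> k = k' + 1"
      "n + 1 - k = n + 1 - k' + 1 \<longleftrightarrow> k' = k + 1"
      "i' + 1 = i + 1 \<longleftrightarrow> i' = i"
      "i' + 1 = i + 1 + 1 \<longleftrightarrow> i' = i + 1"
      "i + 1 = i' + 1 + 1 \<longleftrightarrow> i = i' + 1"
      using d(5) d'(5) by arith+
    then show ?thesis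
      unfolding vw tokens_def prod.case sorted_triple_move_iff[OF d(2,3) d'(2,3)]
        parcs_cubical_staircase_iff
      using v[unfolded vw] w[unfolded vw] by metis
  qed
  finally show ?thesis .
qed

theorem theorem7:
  fixes n :: nat
  assumes "n \<ge> 3"
  shows "digraph_iso (with_proj (token_graph 3 (path_graph n))) (with_proj (cubical_staircase n))"
proof -
  interpret C: pair_graph "cubical_staircase n"
    by (rule pair_graph_cubical_staircase)
  have verts: "pverts (cubical_staircase n) = cs_verts n"
    by (simp add: cubical_staircase_def)
  \<comment> \<open>The isomorphism is built in the direction of \<open>tokens\<close> and reversed
    at the end.\<close>
  have "digraph_iso (with_proj (cubical_staircase n)) (with_proj (token_graph 3 (path_graph n)))"
  proof (rule digraph_iso_with_projI)
    show "pair_wf_digraph (cubical_staircase n)" ..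
    show "bij_betw (tokens n) (pverts (cubical_staircase n)) (pverts (token_graph 3 (path_graph n)))"
      unfolding verts by (rule bij_betw_tokens)
    show "parcs (token_graph 3 (path_graph n)) \<subseteq>
        pverts (token_graph 3 (path_graph n)) \<times> pverts (token_graph 3 (path_graph n))"
      by (auto simp: token_graph_def)
  qed (simp add: verts parcs_tokens_iff)
  then show ?thesis
    using digraph_iso_swap[OF C.wf_digraph_axioms] by blast
qed

end
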